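(* Let $n\ge2$, let $m\ge 0$ be an integer, and let $V_m$ be the space of functions on $\mathcal{T}_c$ of the form $$s(a_1,\ldots,a_{n-1})=(a_1a_2\cdots a_{n-1})\,P_m(a_1,\ldots,a_{n-1}),$$ where $P_m$ is a complex polynomial of degree at most $m$ in $a_1,\ldots,a_{n-1}$. Then $V_m$ is invariant under the action $(g s)(x)=s(g^{-1}x)$ of $G_1$, and so is a finite-dimensional representation of $G_1$. The nonzero elements of $V_m$ are not square integrable, i.e. $\int_{(0,\infty)^{n-1}}|s|^2\,\frac{da_1\cdots da_{n-1}}{a_1\cdots a_{n-1}}=\infty$.
   Context: Fix $c\in\mathbb{R}$. The Toda space $\mathcal{T}_c$ is the set of real $n\times n$ matrices $T$ with $T_{ii}=b_i\in\mathbb{R}$, $T_{i,i+1}=a_i>0$, all other entries zero, and $\sum_{i=1}^n b_i=c$. $G_1$ is the group of real lower triangular $n\times n$ matrices with positive diagonal entries and determinant $1$, acting on $\mathcal{T}_c$ by $g\cdot T=[gTg^{-1}]_+$, where $[\cdot]_+$ sets all entries strictly below the diagonal to zero. Functions of $a_1,\ldots,a_{n-1}$ are regarded as functions on $\mathcal{T}_c$; these are the polarized sections of the (trivial) prequantum line bundle. *)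

theory Defs
  imports
    "HOL-Analysis.Analysis"
    "HOL-Library.Function_Algebras"
    "HOL-Algebra.Group_Action"
    "Jordan_Normal_Form.Determinant"
begin

text \<open>Matrix and coordinate indices start at 0: the paper's $b_{i+1}$ is the entry \<open>(i, i)\<close>
  and its $a_{i+1}$ is the entry \<open>(i, i + 1)\<close>.\<close>

definition toda_space :: "nat \<Rightarrow> real \<Rightarrow> real mat set" where
  "toda_space n c = {T \<in> carrier_mat n n.
     (\<forall>i. Suc i < n \<longrightarrow> 0 < T $$ (i, Suc i)) \<and>
     (\<forall>i<n. \<forall>j<n. j \<noteq> i \<and> j \<noteq> Suc i \<longrightarrow> T $$ (i, j) = 0) \<and>
     (\<Sum>i<n. T $$ (i, i)) = c}"

definition G1 :: "nat \<Rightarrow> real mat monoid" where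
  "G1 n = \<lparr>carrier = {g \<in> carrier_mat n n.
       (\<forall>i<n. \<forall>j<n. i < j \<longrightarrow> g $$ (i, j) = 0) \<and>
       (\<forall>i<n. 0 < g $$ (i, i)) \<and> Determinant.det g = 1},
     mult = (*), one = 1\<^sub>m n\<rparr>"

definition upper_part :: "real mat \<Rightarrow> real mat" where
  "upper_part A = mat (dim_row A) (dim_col A) (\<lambda>(i, j). if j < i then 0 else A $$ (i, j))"

definition toda_act :: "nat \<Rightarrow> real mat \<Rightarrow> real mat \<Rightarrow> real mat" where
  "toda_act n g T = upper_part (g * T * inv\<^bsub>G1 n\<^esub> g)"

text \<open>A complex function on the Toda space is represented by its extension by zero to all
  matrices, so that these functions form a linear subspace of the pointwise function space.\<close>

definition fun_act ::
  "nat \<Rightarrow> real \<Rightarrow> real mat \<Rightarrow> (real mat \<Rightarrow> complex) \<Rightarrow> (real mat \<Rightarrow> complex)" where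
  "fun_act n c g s = (\<lambda>x. if x \<in> toda_space n c then s (toda_act n (inv\<^bsub>G1 n\<^esub> g) x) else 0)"

text \<open>Coordinate tuples are elements of \<open>{..<n - 1} \<rightarrow>\<^sub>E UNIV\<close>, the space of the product
  Lebesgue measure \<open>\<Pi>\<^sub>M i\<in>{..<n - 1}. lborel\<close>.\<close>

definition a_coords :: "nat \<Rightarrow> real mat \<Rightarrow> (nat \<Rightarrow> real)" where
  "a_coords n T = (\<lambda>i\<in>{..<n - 1}. T $$ (i, Suc i))"

definition as_toda_fun :: "nat \<Rightarrow> real \<Rightarrow> ((nat \<Rightarrow> real) \<Rightarrow> complex) \<Rightarrow> (real mat \<Rightarrow> complex)" where
  "as_toda_fun n c f = (\<lambda>T. if T \<in> toda_space n c then f (a_coords n T) else 0)"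

text \<open>Complex polynomial functions of total degree at most \<open>m\<close> in \<open>k\<close> real variables. The bound
  \<open>{..m}\<close> on the single exponents is implied by the bound on their sum.\<close>

definition poly_funs :: "nat \<Rightarrow> nat \<Rightarrow> ((nat \<Rightarrow> real) \<Rightarrow> complex) set" where
  "poly_funs k m = {P. \<exists>coef :: (nat \<Rightarrow> nat) \<Rightarrow> complex.
     P = (\<lambda>a. \<Sum>\<alpha> \<in> {\<alpha> \<in> {..<k} \<rightarrow>\<^sub>E {..m}. (\<Sum>i<k. \<alpha> i) \<le> m}.
                coef \<alpha> * (\<Prod>i<k. complex_of_real (a i) ^ \<alpha> i))}"

definition V_space :: "nat \<Rightarrow> real \<Rightarrow> nat \<Rightarrow> (real mat \<Rightarrow> complex) set" where
  "V_space n c m = {as_toda_fun n c (\<lambda>a. complex_of_real (\<Prod>i<n - 1. a i) * P a) | P.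
     P \<in> poly_funs (n - 1) m}"

definition fscale :: "complex \<Rightarrow> ('a \<Rightarrow> complex) \<Rightarrow> ('a \<Rightarrow> complex)" where
  "fscale k f = (\<lambda>x. k * f x)"

global_interpretation cfun: vector_space fscale
  by unfold_locales (auto simp: fscale_def fun_eq_iff algebra_simps)

definition finite_dim_rep ::
  "'g monoid \<Rightarrow> ('a \<Rightarrow> complex) set \<Rightarrow> ('g \<Rightarrow> ('a \<Rightarrow> complex) \<Rightarrow> ('a \<Rightarrow> complex)) \<Rightarrow> bool" where
  "finite_dim_rep G W \<rho> \<longleftrightarrow>
     cfun.subspace W \<and> (\<exists>B. finite B \<and> B \<subseteq> W \<and> cfun.span B = W) \<and>
     group_action G W (\<lambda>g. restrict (\<rho> g) W) \<and>
     (\<forall>g\<in>carrier G. \<forall>s\<in>W. \<forall>t\<in>W. \<rho> g (s + t) = \<rho> g s + \<rho> g t) \<and>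
     (\<forall>g\<in>carrier G. \<forall>k. \<forall>s\<in>W. \<rho> g (fscale k s) = fscale k (\<rho> g s))"

text \<open>The squared norm of a function of \<open>k\<close> positive coordinates, with respect to
  $da_1 \cdots da_k / (a_1 \cdots a_k)$, as an extended nonnegative real.\<close>

definition L2_sq :: "nat \<Rightarrow> ((nat \<Rightarrow> real) \<Rightarrow> complex) \<Rightarrow> ennreal" where
  "L2_sq k f = (\<integral>\<^sup>+ a \<in> ({..<k} \<rightarrow>\<^sub>E {0<..}). ennreal ((cmod (f a))\<^sup>2 / (\<Prod>i<k. a i))
     \<partial>(\<Pi>\<^sub>M i\<in>{..<k}. lborel))"

end

theory Submission
  imports Defs "HOL-Computational_Algebra.Fundamental_Theorem_Algebra"
begin

text \<open>For lower triangular \<open>g\<close> and upper bidiagonal \<open>T\<close>, nothing of \<open>g T g\<^sup>-\<^sup>1\<close> lies above the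
  superdiagonal, and on the superdiagonal only the diagonal of \<open>g\<close> matters: the coordinate
  \<open>a\<^sub>i\<close> is multiplied by the positive number \<open>g\<^sub>i\<^sub>i / g\<^sub>i\<^sub>+\<^sub>1\<^sub>,\<^sub>i\<^sub>+\<^sub>1\<close>, while the trace is preserved
  (\<open>toda_act_coords\<close>). So on functions of the \<open>a\<^sub>i\<close> the group acts through a torus that rescales
  the coordinates (\<open>fun_act_as_toda_fun\<close>). Every monomial in the \<open>a\<^sub>i\<close> is then a common
  eigenvector (\<open>fun_act_weight_fun\<close>), and since \<open>V\<^sub>m\<close> is the span of finitely many of them
  (\<open>V_space_eq_span\<close>), it is an invariant, finite-dimensional subspace.

  For a nonzero \<open>s = (a\<^sub>1 \<cdots> a\<^sub>k) P\<close> with \<open>k = n - 1 \<ge> 1\<close> the squared norm is the integral of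
  \<open>a\<^sub>1 \<cdots> a\<^sub>k |P|\<^sup>2\<close> with respect to Lebesgue measure. Freeze all coordinates but the last.
  The integrand becomes a positive constant times \<open>t |p(t)|\<^sup>2\<close> for a polynomial \<open>p\<close> in one variable,
  which stays away from zero for large \<open>t\<close> unless \<open>p = 0\<close>; so the inner integral is infinite
  (\<open>nn_integral_poly_half_line\<close>). By continuity \<open>p \<noteq> 0\<close> for frozen coordinates in a box of
  positive measure, and Tonelli's theorem yields the divergence
  (\<open>nn_integral_poly_fun_orthant\<close>).\<close>

section \<open>The group of lower triangular matrices\<close>

definition lower_tri :: "nat \<Rightarrow> real mat \<Rightarrow> bool" where
  "lower_tri n g \<longleftrightarrow> g \<in> carrier_mat n n \<and> (\<forall>i<n. \<forall>j<n. i < j \<longrightarrow> g $$ (i, j) = 0)"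

lemma G1_iff:
  "g \<in> carrier (G1 n) \<longleftrightarrow>
     lower_tri n g \<and> (\<forall>i<n. 0 < g $$ (i, i)) \<and> Determinant.det g = 1"
  by (auto simp: G1_def lower_tri_def)

lemma index_mult_mat_sum:
  fixes A B :: "'a :: semiring_0 mat"
  assumes "A \<in> carrier_mat n n" "B \<in> carrier_mat n n" "i < n" "j < n"
  shows "(A * B) $$ (i, j) = (\<Sum>l<n. A $$ (i, l) * B $$ (l, j))"
  using assms by (simp add: scalar_prod_def atLeast0LessThan)

lemma lower_tri_mult:
  assumes "lower_tri n g" "lower_tri n h"
  shows "lower_tri n (g * h)"
    and "i < n \<Longrightarrow> (g * h) $$ (i, i) = g $$ (i, i) * h $$ (i, i)"
proof -
  have c: "g \<in> carrier_mat n n" "h \<in> carrier_mat n n"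
    and z: "\<And>i j. i < n \<Longrightarrow> j < n \<Longrightarrow> i < j \<Longrightarrow> g $$ (i, j) = 0"
      "\<And>i j. i < n \<Longrightarrow> j < n \<Longrightarrow> i < j \<Longrightarrow> h $$ (i, j) = 0"
    using assms by (auto simp: lower_tri_def)
  have "(g * h) $$ (i, j) = 0" if "i < n" "j < n" "i < j" for i j
  proof -
    have "g $$ (i, l) * h $$ (l, j) = 0" if "l < n" for l
      using z(1)[of i l] z(2)[of l j] that \<open>i < n\<close> \<open>j < n\<close> \<open>i < j\<close> by (cases "l < j") auto
    then have "(\<Sum>l<n. g $$ (i, l) * h $$ (l, j)) = 0"
      by (intro sum.neutral) auto
    then show ?thesis
      using that c by (simp add: index_mult_mat_sum del: index_mult_mat(1))
  qed
  then show "lower_tri n (g * h)"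
    using c by (auto simp: lower_tri_def)
  show "(g * h) $$ (i, i) = g $$ (i, i) * h $$ (i, i)" if "i < n"
  proof -
    have "(\<Sum>l<n. g $$ (i, l) * h $$ (l, i)) = (\<Sum>l\<in>{i}. g $$ (i, l) * h $$ (l, i))"
    proof (rule sum.mono_neutral_right)
      show "\<forall>l\<in>{..<n} - {i}. g $$ (i, l) * h $$ (l, i) = 0"
      proof
        fix l assume "l \<in> {..<n} - {i}"
        then show "g $$ (i, l) * h $$ (l, i) = 0"
          using z(1)[of i l] z(2)[of l i] that by (cases "l < i") auto
      qed
    qed (use that in auto)
    then show ?thesis
      using that c by (simp add: index_mult_mat_sum del: index_mult_mat(1))
  qed
qed

text \<open>Row \<open>i\<close> of \<open>g * h = 1\<close> involves only the rows \<open>0, \<dots>, i\<close> of \<open>h\<close>, and the coefficient of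
  row \<open>i\<close> is a nonzero diagonal entry: this is forward substitution.\<close>

lemma lower_tri_right_inverse:
  assumes g: "lower_tri n g" and nz: "\<And>i. i < n \<Longrightarrow> g $$ (i, i) \<noteq> 0"
    and h: "h \<in> carrier_mat n n" and gh: "g * h = 1\<^sub>m n"
  shows "lower_tri n h"
proof -
  have c: "g \<in> carrier_mat n n"
    and z: "\<And>i j. i < n \<Longrightarrow> j < n \<Longrightarrow> i < j \<Longrightarrow> g $$ (i, j) = 0"
    using g by (auto simp: lower_tri_def)
  have "i < n \<Longrightarrow> i < j \<Longrightarrow> j < n \<Longrightarrow> h $$ (i, j) = 0" for i j
  proof (induction i rule: less_induct)
    case (less i)
    have "0 = (g * h) $$ (i, j)"
      using less.prems gh by simp
    also have "\<dots> = (\<Sum>l<n. g $$ (i, l) * h $$ (l, j))"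
      using less.prems c h by (intro index_mult_mat_sum) auto
    also have "\<dots> = (\<Sum>l\<in>{i}. g $$ (i, l) * h $$ (l, j))"
    proof (rule sum.mono_neutral_right)
      show "\<forall>l\<in>{..<n} - {i}. g $$ (i, l) * h $$ (l, j) = 0"
      proof
        fix l assume "l \<in> {..<n} - {i}"
        then show "g $$ (i, l) * h $$ (l, j) = 0"
          using z[of i l] less.IH[of l] less.prems by (cases "l < i") auto
      qed
    qed (use less.prems in auto)
    finally show ?case
      using nz[of i] less.prems by simp
  qed
  then show ?thesis
    using h by (auto simp: lower_tri_def)
qed

text \<open>As the determinant is 1, the adjugate is the inverse.\<close>

lemma G1_left_inverse:
  assumes g: "g \<in> carrier (G1 n)"
  shows "\<exists>h\<in>carrier (G1 n). h * g = 1\<^sub>m n"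
proof -
  define h where "h = adj_mat g"
  have lt: "lower_tri n g" and pos: "\<And>i. i < n \<Longrightarrow> 0 < g $$ (i, i)"
    and det: "Determinant.det g = 1" and c: "g \<in> carrier_mat n n"
    using g by (auto simp: G1_iff lower_tri_def)
  have h: "h \<in> carrier_mat n n" "g * h = 1\<^sub>m n" "h * g = 1\<^sub>m n"
    using adj_mat[OF c] det by (auto simp: h_def)
  have lth: "lower_tri n h"
    using lower_tri_right_inverse[OF lt _ h(1,2)] pos by (metis less_irrefl)
  have "0 < h $$ (i, i)" if "i < n" for i
  proof -
    have "g $$ (i, i) * h $$ (i, i) = 1"
      using lower_tri_mult(2)[OF lt lth that] h(2) that by simp
    then show ?thesis
      using pos[OF that] zero_less_mult_pos[of "g $$ (i, i)" "h $$ (i, i)"] by simp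
  qed
  moreover have "Determinant.det h = 1"
    using det_mult[OF c h(1)] det h(2) by simp
  ultimately show ?thesis
    using lth h(3) by (auto simp: G1_iff)
qed

lemma one_mat_in_G1: "1\<^sub>m n \<in> carrier (G1 n)"
  by (auto simp: G1_iff lower_tri_def)

lemma group_G1: "group (G1 n)"
proof (rule groupI)
  fix x y assume xy: "x \<in> carrier (G1 n)" "y \<in> carrier (G1 n)"
  then have "Determinant.det (x * y) = 1"
    using det_mult[of x n y] by (auto simp: G1_iff lower_tri_def)
  with xy have "x * y \<in> carrier (G1 n)"
    using lower_tri_mult[of n x y] by (simp add: G1_iff del: index_mult_mat(1))
  then show "x \<otimes>\<^bsub>G1 n\<^esub> y \<in> carrier (G1 n)"
    by (simp add: G1_def)
next
  fix x y z assume "x \<in> carrier (G1 n)" "y \<in> carrier (G1 n)" "z \<in> carrier (G1 n)"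
  then show "x \<otimes>\<^bsub>G1 n\<^esub> y \<otimes>\<^bsub>G1 n\<^esub> z = x \<otimes>\<^bsub>G1 n\<^esub> (y \<otimes>\<^bsub>G1 n\<^esub> z)"
    by (auto simp: G1_def intro!: assoc_mult_mat)
next
  fix x assume "x \<in> carrier (G1 n)"
  then show "\<exists>y\<in>carrier (G1 n). y \<otimes>\<^bsub>G1 n\<^esub> x = \<one>\<^bsub>G1 n\<^esub>"
    using G1_left_inverse[of x n] by (simp add: G1_def[of n])
qed (use one_mat_in_G1 in \<open>auto simp: G1_def\<close>)

lemma G1_inv:
  assumes "g \<in> carrier (G1 n)"
  shows "inv\<^bsub>G1 n\<^esub> g \<in> carrier (G1 n)" "inv\<^bsub>G1 n\<^esub> (inv\<^bsub>G1 n\<^esub> g) = g"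
    and "inv\<^bsub>G1 n\<^esub> g * g = 1\<^sub>m n"
    and "i < n \<Longrightarrow> (inv\<^bsub>G1 n\<^esub> g) $$ (i, i) = 1 / g $$ (i, i)"
proof -
  interpret group "G1 n" by (rule group_G1)
  show inv: "inv\<^bsub>G1 n\<^esub> g \<in> carrier (G1 n)" "inv\<^bsub>G1 n\<^esub> (inv\<^bsub>G1 n\<^esub> g) = g"
    using assms by auto
  show one: "inv\<^bsub>G1 n\<^esub> g * g = 1\<^sub>m n"
    using l_inv[OF assms] by (simp add: G1_def)
  assume i: "i < n"
  have "(inv\<^bsub>G1 n\<^esub> g) $$ (i, i) * g $$ (i, i) = (inv\<^bsub>G1 n\<^esub> g * g) $$ (i, i)"
    using lower_tri_mult(2)[of n "inv\<^bsub>G1 n\<^esub> g" g i] assms inv i by (simp add: G1_iff)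
  then have "(inv\<^bsub>G1 n\<^esub> g) $$ (i, i) * g $$ (i, i) = 1"
    using i one by simp
  moreover have "g $$ (i, i) > 0"
    using assms i by (auto simp: G1_iff)
  ultimately show "(inv\<^bsub>G1 n\<^esub> g) $$ (i, i) = 1 / g $$ (i, i)"
    by (simp add: field_simps)
qed

section \<open>The action in the coordinates on the superdiagonal\<close>

lemma sum_diag_mult_commute:
  fixes A B :: "'a :: comm_semiring_0 mat"
  assumes "A \<in> carrier_mat n n" "B \<in> carrier_mat n n"
  shows "(\<Sum>i<n. (A * B) $$ (i, i)) = (\<Sum>i<n. (B * A) $$ (i, i))"
proof -
  have "(\<Sum>i<n. (A * B) $$ (i, i)) = (\<Sum>i<n. \<Sum>j<n. A $$ (i, j) * B $$ (j, i))"
    using assms by (intro sum.cong refl index_mult_mat_sum) auto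
  also have "\<dots> = (\<Sum>j<n. \<Sum>i<n. B $$ (j, i) * A $$ (i, j))"
    by (subst sum.swap) (simp add: mult.commute)
  also have "\<dots> = (\<Sum>j<n. (B * A) $$ (j, j))"
    using assms by (intro sum.cong refl index_mult_mat_sum[symmetric]) auto
  finally show ?thesis .
qed

text \<open>Multiplying by a lower triangular matrix on either side keeps the entries above the
  superdiagonal zero: \<open>T h\<close> combines each row of \<open>h\<close> only with the next one, and \<open>g\<close> adds to a row
  only multiples of earlier rows, which end further left. Hence a superdiagonal entry of the
  product is a single product.\<close>

lemma toda_conj_entries:
  assumes T: "T \<in> toda_space n c" and g: "lower_tri n g" and h: "lower_tri n h"
    and ij: "i < n" "j < n"
  shows "Suc i < j \<Longrightarrow> (g * (T * h)) $$ (i, j) = 0"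
    and "j = Suc i \<Longrightarrow> (g * (T * h)) $$ (i, j) = g $$ (i, i) * T $$ (i, j) * h $$ (j, j)"
proof -
  have c: "g \<in> carrier_mat n n" "h \<in> carrier_mat n n" "T \<in> carrier_mat n n"
    and zg: "\<And>i j. i < n \<Longrightarrow> j < n \<Longrightarrow> i < j \<Longrightarrow> g $$ (i, j) = 0"
    and zh: "\<And>i j. i < n \<Longrightarrow> j < n \<Longrightarrow> i < j \<Longrightarrow> h $$ (i, j) = 0"
    and zT: "\<And>i j. i < n \<Longrightarrow> j < n \<Longrightarrow> j \<noteq> i \<Longrightarrow> j \<noteq> Suc i \<Longrightarrow> T $$ (i, j) = 0"
    using assms by (auto simp: lower_tri_def toda_space_def)
  have X0: "(T * h) $$ (l, j) = 0" if "l < n" "Suc l < j" "j < n" for l j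
  proof -
    have "T $$ (l, p) * h $$ (p, j) = 0" if "p < n" for p
      using zT[of l p] zh[of p j] that \<open>l < n\<close> \<open>Suc l < j\<close> \<open>j < n\<close> by (cases "p < j") auto
    then have "(\<Sum>p<n. T $$ (l, p) * h $$ (p, j)) = 0"
      by (intro sum.neutral) auto
    then show ?thesis
      using that c by (simp add: index_mult_mat_sum del: index_mult_mat(1))
  qed
  have X1: "(T * h) $$ (i, Suc i) = T $$ (i, Suc i) * h $$ (Suc i, Suc i)" if "Suc i < n" for i
  proof -
    have "(\<Sum>l<n. T $$ (i, l) * h $$ (l, Suc i)) = (\<Sum>l\<in>{Suc i}. T $$ (i, l) * h $$ (l, Suc i))"
    proof (rule sum.mono_neutral_right)
      show "\<forall>l\<in>{..<n} - {Suc i}. T $$ (i, l) * h $$ (l, Suc i) = 0"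
      proof
        fix l assume "l \<in> {..<n} - {Suc i}"
        then show "T $$ (i, l) * h $$ (l, Suc i) = 0"
          using zT[of i l] zh[of i "Suc i"] that by (cases "l = i") auto
      qed
    qed (use that in auto)
    then show ?thesis
      using that c by (simp add: index_mult_mat_sum del: index_mult_mat(1))
  qed
  have e: "(g * (T * h)) $$ (i, j) = (\<Sum>l<n. g $$ (i, l) * (T * h) $$ (l, j))"
    using ij c by (intro index_mult_mat_sum) auto
  show "(g * (T * h)) $$ (i, j) = 0" if "Suc i < j"
  proof -
    have "g $$ (i, l) * (T * h) $$ (l, j) = 0" if "l < n" for l
      using zg[of i l] X0[of l j] that ij \<open>Suc i < j\<close> by (cases "l \<le> i") auto
    then show ?thesis
      unfolding e by (intro sum.neutral) auto
  qed
  show "(g * (T * h)) $$ (i, j) = g $$ (i, i) * T $$ (i, j) * h $$ (j, j)" if j: "j = Suc i"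
  proof -
    have "(\<Sum>l<n. g $$ (i, l) * (T * h) $$ (l, j)) = (\<Sum>l\<in>{i}. g $$ (i, l) * (T * h) $$ (l, j))"
    proof (rule sum.mono_neutral_right)
      show "\<forall>l\<in>{..<n} - {i}. g $$ (i, l) * (T * h) $$ (l, j) = 0"
      proof
        fix l assume "l \<in> {..<n} - {i}"
        then show "g $$ (i, l) * (T * h) $$ (l, j) = 0"
          using zg[of i l] X0[of l j] ij j by (cases "l < i") auto
      qed
    qed (use ij in auto)
    then show ?thesis
      unfolding e using X1[of i] j ij by simp
  qed
qed

lemma toda_act_coords:
  assumes T: "T \<in> toda_space n c" and g: "g \<in> carrier (G1 n)"
  shows "toda_act n g T \<in> toda_space n c"
    and "Suc i < n \<Longrightarrow> toda_act n g T $$ (i, Suc i) =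
      g $$ (i, i) / g $$ (Suc i, Suc i) * T $$ (i, Suc i)"
proof -
  define h where "h = inv\<^bsub>G1 n\<^esub> g"
  have hG: "h \<in> carrier (G1 n)"
    using G1_inv(1)[OF g] by (simp add: h_def)
  have lt: "lower_tri n g" "lower_tri n h" and c: "g \<in> carrier_mat n n" "h \<in> carrier_mat n n"
    "T \<in> carrier_mat n n"
    using g hG T by (auto simp: G1_iff lower_tri_def toda_space_def)
  define Y where "Y = g * (T * h)"
  have Y: "Y \<in> carrier_mat n n"
    using c by (simp add: Y_def)
  have act: "toda_act n g T = upper_part Y"
    using c by (simp add: toda_act_def Y_def h_def[symmetric])
  have up: "upper_part Y \<in> carrier_mat n n"
    "\<And>i j. i < n \<Longrightarrow> j < n \<Longrightarrow> upper_part Y $$ (i, j) = (if j < i then 0 else Y $$ (i, j))"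
    using Y by (auto simp: upper_part_def)
  have "(\<Sum>i<n. Y $$ (i, i)) = (\<Sum>i<n. ((T * h) * g) $$ (i, i))"
    unfolding Y_def using c by (intro sum_diag_mult_commute) auto
  also have "(T * h) * g = T"
    using c G1_inv(3)[OF g] by (simp add: h_def)
  also have "(\<Sum>i<n. T $$ (i, i)) = c"
    using T by (simp add: toda_space_def)
  finally have tr: "(\<Sum>i<n. upper_part Y $$ (i, i)) = c"
    using up(2) by simp
  have sup: "upper_part Y $$ (i, Suc i) = g $$ (i, i) / g $$ (Suc i, Suc i) * T $$ (i, Suc i)"
    if "Suc i < n" for i
    using that up(2)[of i "Suc i"] toda_conj_entries(2)[OF T lt, of i "Suc i"]
      G1_inv(4)[OF g, of "Suc i"] by (simp add: Y_def h_def)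
  have "0 < upper_part Y $$ (i, Suc i)" if "Suc i < n" for i
    unfolding sup[OF that] using g T that by (auto simp: G1_iff toda_space_def)
  moreover have "upper_part Y $$ (i, j) = 0" if "i < n" "j < n" "j \<noteq> i" "j \<noteq> Suc i" for i j
    using that up(2)[of i j] toda_conj_entries(1)[OF T lt, of i j] by (auto simp: Y_def)
  ultimately show "toda_act n g T \<in> toda_space n c"
    using up(1) tr by (simp add: act toda_space_def)
  show "Suc i < n \<Longrightarrow> toda_act n g T $$ (i, Suc i) =
      g $$ (i, i) / g $$ (Suc i, Suc i) * T $$ (i, Suc i)"
    using sup by (simp add: act)
qed

text \<open>The factors are those by which \<open>g\<^sup>-\<^sup>1\<close> acts, matching \<open>(g s)(x) = s (g\<^sup>-\<^sup>1 x)\<close>. The result is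
  extensional because coordinate tuples are.\<close>

definition torus_scale :: "nat \<Rightarrow> real mat \<Rightarrow> (nat \<Rightarrow> real) \<Rightarrow> (nat \<Rightarrow> real)" where
  "torus_scale n g a = (\<lambda>i\<in>{..<n - 1}. g $$ (Suc i, Suc i) / g $$ (i, i) * a i)"

lemma fun_act_as_toda_fun:
  assumes g: "g \<in> carrier (G1 n)"
  shows "fun_act n c g (as_toda_fun n c f) = as_toda_fun n c (\<lambda>a. f (torus_scale n g a))"
proof (rule ext)
  fix T
  let ?g' = "inv\<^bsub>G1 n\<^esub> g"
  note g' = G1_inv(1)[OF g]
  have "a_coords n (toda_act n ?g' T) = torus_scale n g (a_coords n T)"
    if "T \<in> toda_space n c"
    by (auto simp: a_coords_def torus_scale_def restrict_def fun_eq_iff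
        toda_act_coords(2)[OF that g'] G1_inv(4)[OF g])
  then show "fun_act n c g (as_toda_fun n c f) T =
      as_toda_fun n c (\<lambda>a. f (torus_scale n g a)) T"
    using toda_act_coords(1)[OF _ g'] by (auto simp: fun_act_def as_toda_fun_def)
qed

lemma torus_scale_mult:
  assumes "g \<in> carrier (G1 n)" "h \<in> carrier (G1 n)"
  shows "torus_scale n (g * h) a = torus_scale n h (torus_scale n g a)"
  using assms lower_tri_mult(2)[of n g h]
  by (auto simp: torus_scale_def G1_iff restrict_def fun_eq_iff)

section \<open>The representation\<close>

definition exps :: "nat \<Rightarrow> nat \<Rightarrow> (nat \<Rightarrow> nat) set" where
  "exps k m = {\<alpha> \<in> {..<k} \<rightarrow>\<^sub>E {..m}. (\<Sum>i<k. \<alpha> i) \<le> m}"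

text \<open>The exponents are shifted by one to absorb the factor \<open>a\<^sub>1 \<cdots> a\<^sub>n\<^sub>-\<^sub>1\<close> in front of the
  polynomial.\<close>

definition weight_fun :: "nat \<Rightarrow> real \<Rightarrow> (nat \<Rightarrow> nat) \<Rightarrow> real mat \<Rightarrow> complex" where
  "weight_fun n c \<alpha> = as_toda_fun n c (\<lambda>a. \<Prod>i<n - 1. complex_of_real (a i) ^ Suc (\<alpha> i))"

lemma finite_exps: "finite (exps k m)"
  unfolding exps_def by (rule finite_subset[of _ "{..<k} \<rightarrow>\<^sub>E {..m}"]) (auto intro: finite_PiE)

lemma sum_fun_apply: "sum F A x = (\<Sum>\<alpha>\<in>A. F \<alpha> x)"
  by (induction A rule: infinite_finite_induct) auto

lemma as_toda_fun_sum_weight: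
  "as_toda_fun n c (\<lambda>a. complex_of_real (\<Prod>i<n - 1. a i) *
      (\<Sum>\<alpha>\<in>exps (n - 1) m. coef \<alpha> * (\<Prod>i<n - 1. complex_of_real (a i) ^ \<alpha> i))) =
    (\<Sum>\<alpha>\<in>exps (n - 1) m. fscale (coef \<alpha>) (weight_fun n c \<alpha>))"
  by (auto simp: fun_eq_iff sum_fun_apply fscale_def weight_fun_def as_toda_fun_def
      sum_distrib_left prod.distrib intro!: sum.cong)

lemma V_space_eq:
  "V_space n c m = range (\<lambda>coef. \<Sum>\<alpha>\<in>exps (n - 1) m. fscale (coef \<alpha>) (weight_fun n c \<alpha>))"
proof (intro subset_antisym subsetI)
  fix s assume "s \<in> V_space n c m"
  then obtain coef where "s = as_toda_fun n c (\<lambda>a. complex_of_real (\<Prod>i<n - 1. a i) *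
      (\<Sum>\<alpha>\<in>exps (n - 1) m. coef \<alpha> * (\<Prod>i<n - 1. complex_of_real (a i) ^ \<alpha> i)))"
    unfolding V_space_def poly_funs_def exps_def mem_Collect_eq by (elim exE conjE) simp
  then show "s \<in> range (\<lambda>coef. \<Sum>\<alpha>\<in>exps (n - 1) m. fscale (coef \<alpha>) (weight_fun n c \<alpha>))"
    unfolding as_toda_fun_sum_weight by (rule range_eqI[where x = coef])
next
  fix s assume "s \<in> range (\<lambda>coef. \<Sum>\<alpha>\<in>exps (n - 1) m. fscale (coef \<alpha>) (weight_fun n c \<alpha>))"
  then obtain coef where "s = as_toda_fun n c (\<lambda>a. complex_of_real (\<Prod>i<n - 1. a i) *
      (\<Sum>\<alpha>\<in>exps (n - 1) m. coef \<alpha> * (\<Prod>i<n - 1. complex_of_real (a i) ^ \<alpha> i)))"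
    unfolding as_toda_fun_sum_weight by (rule rangeE)
  then show "s \<in> V_space n c m"
    unfolding V_space_def poly_funs_def exps_def mem_Collect_eq
    by (intro exI conjI) (assumption, rule refl)
qed

lemma V_space_eq_span: "V_space n c m = cfun.span (weight_fun n c ` exps (n - 1) m)"
proof
  show "V_space n c m \<subseteq> cfun.span (weight_fun n c ` exps (n - 1) m)"
    unfolding V_space_eq
    by (auto simp del: One_nat_def intro!: cfun.span_sum cfun.span_scale[OF cfun.span_base])
  have "cfun.subspace (V_space n c m)"
  proof (rule cfun.subspaceI)
    show "0 \<in> V_space n c m"
      unfolding V_space_eq
      by (rule range_eqI[where x = "\<lambda>_. 0"]) (simp add: fscale_def fun_eq_iff sum_fun_apply)
  next
    fix s t assume "s \<in> V_space n c m" "t \<in> V_space n c m"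
    then obtain p q where
      "s = (\<Sum>\<alpha>\<in>exps (n - 1) m. fscale (p \<alpha>) (weight_fun n c \<alpha>))"
      "t = (\<Sum>\<alpha>\<in>exps (n - 1) m. fscale (q \<alpha>) (weight_fun n c \<alpha>))"
      by (auto simp: V_space_eq)
    then have "s + t = (\<Sum>\<alpha>\<in>exps (n - 1) m. fscale (p \<alpha> + q \<alpha>) (weight_fun n c \<alpha>))"
      by (simp add: cfun.scale_left_distrib sum.distrib)
    then show "s + t \<in> V_space n c m"
      unfolding V_space_eq by (rule range_eqI[where x = "\<lambda>\<alpha>. p \<alpha> + q \<alpha>"])
  next
    fix k s assume "s \<in> V_space n c m"
    then obtain p where "s = (\<Sum>\<alpha>\<in>exps (n - 1) m. fscale (p \<alpha>) (weight_fun n c \<alpha>))"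
      by (auto simp: V_space_eq)
    then have "fscale k s = (\<Sum>\<alpha>\<in>exps (n - 1) m. fscale (k * p \<alpha>) (weight_fun n c \<alpha>))"
      by (simp add: cfun.scale_sum_right)
    then show "fscale k s \<in> V_space n c m"
      unfolding V_space_eq by (rule range_eqI[where x = "\<lambda>\<alpha>. k * p \<alpha>"])
  qed
  moreover have "weight_fun n c \<beta> \<in> V_space n c m" if "\<beta> \<in> exps (n - 1) m" for \<beta>
    unfolding V_space_eq
  proof (rule range_eqI[where x = "\<lambda>\<alpha>. if \<alpha> = \<beta> then 1 else 0"])
    have "(\<Sum>\<alpha>\<in>exps (n - 1) m. fscale (if \<alpha> = \<beta> then 1 else 0) (weight_fun n c \<alpha>)) =
        (\<Sum>\<alpha>\<in>exps (n - 1) m. if \<alpha> = \<beta> then weight_fun n c \<alpha> else 0)"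
      by (intro sum.cong) auto
    then show "weight_fun n c \<beta> =
        (\<Sum>\<alpha>\<in>exps (n - 1) m. fscale (if \<alpha> = \<beta> then 1 else 0) (weight_fun n c \<alpha>))"
      using that by (simp add: finite_exps)
  qed
  ultimately show "cfun.span (weight_fun n c ` exps (n - 1) m) \<subseteq> V_space n c m"
    by (intro cfun.span_minimal) auto
qed

lemma fun_act_add: "fun_act n c g (s + t) = fun_act n c g s + fun_act n c g t"
  by (auto simp: fun_act_def)

lemma fun_act_fscale: "fun_act n c g (fscale k s) = fscale k (fun_act n c g s)"
  by (auto simp: fun_act_def fscale_def)

lemma fun_act_weight_fun:
  assumes "g \<in> carrier (G1 n)"
  shows "fun_act n c g (weight_fun n c \<alpha>) =
    fscale (\<Prod>i<n - 1. complex_of_real (g $$ (Suc i, Suc i) / g $$ (i, i)) ^ Suc (\<alpha> i))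
      (weight_fun n c \<alpha>)"
proof -
  have "(\<Prod>i<n - 1. complex_of_real (torus_scale n g a i) ^ Suc (\<alpha> i)) =
      (\<Prod>i<n - 1. complex_of_real (g $$ (Suc i, Suc i) / g $$ (i, i)) ^ Suc (\<alpha> i)) *
      (\<Prod>i<n - 1. complex_of_real (a i) ^ Suc (\<alpha> i))" for a
  proof (subst prod.distrib[symmetric], rule prod.cong)
    fix i assume "i \<in> {..<n - 1}"
    then have "complex_of_real (torus_scale n g a i) =
        complex_of_real (g $$ (Suc i, Suc i) / g $$ (i, i)) * complex_of_real (a i)"
      by (simp add: torus_scale_def)
    then show "complex_of_real (torus_scale n g a i) ^ Suc (\<alpha> i) =
        complex_of_real (g $$ (Suc i, Suc i) / g $$ (i, i)) ^ Suc (\<alpha> i) *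
        complex_of_real (a i) ^ Suc (\<alpha> i)"
      by (simp only: power_mult_distrib)
  qed simp
  then show ?thesis
    unfolding weight_fun_def fun_act_as_toda_fun[OF assms]
    by (simp only: as_toda_fun_def fscale_def if_distrib mult_zero_right)
qed

lemma fun_act_V_space:
  assumes "g \<in> carrier (G1 n)" "s \<in> V_space n c m"
  shows "fun_act n c g s \<in> V_space n c m"
  using assms(2) unfolding V_space_eq_span
proof (induction rule: cfun.span_induct_alt)
  case base
  have "fun_act n c g 0 = 0"
    by (auto simp: fun_act_def)
  then have "fun_act n c g 0 \<in> cfun.span (weight_fun n c ` exps (n - 1) m)"
    by (simp only: cfun.span_zero)
  then show ?case
    by (simp only: zero_fun_def)
next
  case (step k e s)
  then obtain \<alpha> where \<alpha>: "\<alpha> \<in> exps (n - 1) m" and e: "e = weight_fun n c \<alpha>"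
    by blast
  have "fun_act n c g e \<in> cfun.span (weight_fun n c ` exps (n - 1) m)"
    unfolding e fun_act_weight_fun[OF assms(1)]
    using \<alpha> by (intro cfun.span_scale cfun.span_base imageI)
  with step(2) have "fun_act n c g (fscale k e + s) \<in> cfun.span (weight_fun n c ` exps (n - 1) m)"
    unfolding fun_act_add fun_act_fscale by (intro cfun.span_add cfun.span_scale)
  then show ?case
    by (simp only: plus_fun_def)
qed

text \<open>The composition law needs no computation with matrices on the Toda space: both sides are
  rescalings of the coordinates, by characters of the group.\<close>

lemma fun_act_mult:
  assumes "g \<in> carrier (G1 n)" "h \<in> carrier (G1 n)" "s \<in> V_space n c m"
  shows "fun_act n c (g * h) s = fun_act n c g (fun_act n c h s)"
proof -
  obtain f where s: "s = as_toda_fun n c f"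
    using assms(3) by (auto simp: V_space_def)
  have "g * h \<in> carrier (G1 n)"
    using monoid.m_closed[OF group.is_monoid[OF group_G1] assms(1,2)] by (simp add: G1_def)
  then show ?thesis
    using assms by (simp add: s fun_act_as_toda_fun torus_scale_mult)
qed

lemma fun_act_one:
  assumes "s \<in> V_space n c m"
  shows "fun_act n c (1\<^sub>m n) s = s"
proof -
  obtain f where s: "s = as_toda_fun n c f"
    using assms by (auto simp: V_space_def)
  have "torus_scale n (1\<^sub>m n) (a_coords n T) = a_coords n T" for T
    by (auto simp: torus_scale_def a_coords_def fun_eq_iff)
  then show ?thesis
    unfolding s fun_act_as_toda_fun[OF one_mat_in_G1] by (simp add: as_toda_fun_def cong: if_cong)
qed

lemma finite_dim_rep_V_space: "finite_dim_rep (G1 n) (V_space n c m) (fun_act n c)"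
proof -
  let ?W = "V_space n c m"
  let ?r = "\<lambda>g. restrict (fun_act n c g) ?W"
  have cancel: "fun_act n c (inv\<^bsub>G1 n\<^esub> g) (fun_act n c g s) = s"
    if "g \<in> carrier (G1 n)" "s \<in> ?W" for g s
    using that fun_act_mult[of "inv\<^bsub>G1 n\<^esub> g" n g s] fun_act_one[of s n]
    by (simp add: G1_inv)
  have Bij: "?r g \<in> Bij ?W" if g: "g \<in> carrier (G1 n)" for g
  proof -
    have "bij_betw (fun_act n c g) ?W ?W"
      by (rule bij_betw_byWitness[where f' = "fun_act n c (inv\<^bsub>G1 n\<^esub> g)"])
        (use g cancel[OF g] cancel[OF G1_inv(1)[OF g]] G1_inv[OF g] fun_act_V_space in auto)
    then show ?thesis
      by (auto simp: Bij_def bij_betw_restrict_eq)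
  qed
  have "group_action (G1 n) ?W ?r"
    unfolding group_action_def group_hom_def group_hom_axioms_def
  proof (intro conjI group_G1 group_BijGroup homI)
    fix g h assume gh: "g \<in> carrier (G1 n)" "h \<in> carrier (G1 n)"
    have "?r (g * h) = compose ?W (?r g) (?r h)"
      using gh by (auto simp: compose_def fun_eq_iff fun_act_mult fun_act_V_space)
    moreover have "g \<otimes>\<^bsub>G1 n\<^esub> h = g * h"
      by (simp add: G1_def)
    ultimately show "?r (g \<otimes>\<^bsub>G1 n\<^esub> h) = ?r g \<otimes>\<^bsub>BijGroup ?W\<^esub> ?r h"
      using Bij gh by (simp add: BijGroup_def)
  qed (use Bij in \<open>auto simp: BijGroup_def\<close>)
  moreover have "cfun.subspace ?W"
    by (simp add: V_space_eq_span)
  moreover have "\<exists>B. finite B \<and> B \<subseteq> ?W \<and> cfun.span B = ?W"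
    by (rule exI[of _ "weight_fun n c ` exps (n - 1) m"])
      (auto simp: V_space_eq_span finite_exps intro: cfun.span_base)
  ultimately show ?thesis
    by (simp add: finite_dim_rep_def fun_act_add fun_act_fscale)
qed

section \<open>Divergence of the norm\<close>

text \<open>The polynomial \<open>z p(z)\<^sup>2\<close> is not constant, so it tends to infinity; in particular the
  integrand is eventually at least 1.\<close>

lemma nn_integral_poly_half_line:
  fixes p :: "complex poly" and C :: real
  assumes "p \<noteq> 0" "C > 0"
  shows "(\<integral>\<^sup>+ t\<in>{0<..}. ennreal (C * t * (cmod (poly p (complex_of_real t)))\<^sup>2) \<partial>lborel) = \<infinity>"
proof -
  \<comment> \<open>\<open>pCons 0\<close> is multiplication by \<open>z\<close>, which accounts for the weight \<open>t\<close>.\<close>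
  obtain r where r: "\<And>z :: complex. r \<le> norm z \<Longrightarrow> 1 / C \<le> norm (poly (pCons 0 (p * p)) z)"
    using poly_infinity[of "p * p" "1 / C" 0] assms by auto
  define R where "R = max r 1"
  have ge: "1 \<le> C * t * (cmod (poly p (complex_of_real t)))\<^sup>2" if "R \<le> t" for t
    using r[of "complex_of_real t"] that assms
    by (auto simp: R_def norm_mult power2_eq_square field_simps)
  have "emeasure lborel {R..} = \<infinity>"
  proof -
    have "ennreal (real N) \<le> emeasure lborel {R..}" for N
    proof -
      have "ennreal (real N) = emeasure lborel {R..R + real N}" by simp
      also have "\<dots> \<le> emeasure lborel {R..}" by (intro emeasure_mono) auto
      finally show ?thesis .
    qed
    then show ?thesis
      by (metis ennreal_of_nat_eq_real_of_nat ennreal_Ex_less_of_nat infinity_ennreal_def leD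
          top.not_eq_extremum)
  qed
  then have "\<infinity> = (\<integral>\<^sup>+ t. indicator {R..} t \<partial>lborel)"
    by simp
  also have "\<dots> \<le> (\<integral>\<^sup>+ t\<in>{0<..}. ennreal (C * t * (cmod (poly p (complex_of_real t)))\<^sup>2) \<partial>lborel)"
  proof (rule nn_integral_mono)
    fix t :: real
    show "indicator {R..} t \<le>
        ennreal (C * t * (cmod (poly p (complex_of_real t)))\<^sup>2) * indicator {0<..} t"
      using ge[of t] by (auto simp: indicator_def R_def)
  qed
  finally show ?thesis
    by (simp add: top_unique)
qed

lemma nn_integral_poly_fun_orthant:
  assumes P: "P \<in> poly_funs (Suc r) m"
    and b: "b \<in> {..<Suc r} \<rightarrow>\<^sub>E {0<..}" "P b \<noteq> 0"
  shows "(\<integral>\<^sup>+ a\<in>({..<Suc r} \<rightarrow>\<^sub>E {0<..}). ennreal ((\<Prod>i<Suc r. a i) * (cmod (P a))\<^sup>2)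
    \<partial>(\<Pi>\<^sub>M i\<in>{..<Suc r}. lborel)) = \<infinity>"
proof -
  interpret product_sigma_finite "\<lambda>_ :: nat. lborel :: real measure"
    by standard
  define F where "F a = ennreal ((\<Prod>i<Suc r. a i) * (cmod (P a))\<^sup>2) *
    indicator ({..<Suc r} \<rightarrow>\<^sub>E {0<..}) a" for a :: "nat \<Rightarrow> real"
  obtain coef where P_eq: "P = (\<lambda>a. \<Sum>\<alpha>\<in>exps (Suc r) m.
      coef \<alpha> * (\<Prod>i<Suc r. complex_of_real (a i) ^ \<alpha> i))"
    using P by (auto simp: poly_funs_def exps_def)
  \<comment> \<open>\<open>P\<close> as a polynomial in its last variable, with coefficients depending on the others\<close>
  define q where "q a = (\<Sum>\<alpha>\<in>exps (Suc r) m.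
      Polynomial.monom (coef \<alpha> * (\<Prod>i<r. complex_of_real (a i) ^ \<alpha> i)) (\<alpha> r))" for a
  have slice: "P (a(r := t)) = poly (q a) (complex_of_real t)" for a t
    by (simp add: P_eq q_def poly_sum poly_monom mult_ac)
  have P_meas: "P \<in> borel_measurable (\<Pi>\<^sub>M i\<in>{..<Suc r}. lborel)"
    unfolding P_eq by measurable
  have prod_meas: "(\<lambda>a. \<Prod>i<Suc r. a i) \<in> borel_measurable (\<Pi>\<^sub>M i\<in>{..<Suc r}. lborel :: real measure)"
    by measurable
  have orthant: "({..<Suc r} \<rightarrow>\<^sub>E {0<..}) \<in> sets (\<Pi>\<^sub>M i\<in>{..<Suc r}. lborel :: real measure)"
    by (intro sets_PiM_I_finite) auto
  have F_meas: "F \<in> borel_measurable (\<Pi>\<^sub>M i\<in>insert r {..<r}. lborel)"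
    unfolding F_def lessThan_Suc[symmetric]
    by (intro borel_measurable_times_ennreal borel_measurable_indicator orthant
        measurable_compose[OF _ measurable_ennreal] borel_measurable_times prod_meas
        borel_measurable_power measurable_compose[OF P_meas borel_measurable_norm])
  \<comment> \<open>\<open>q a\<close> takes a nonzero value at \<open>b r\<close> for all \<open>a\<close> near \<open>b\<close>, hence on a box \<open>U\<close>.\<close>
  define b' where "b' = restrict b {..<r}"
  have "continuous_on UNIV (\<lambda>a :: nat \<Rightarrow> real. P (a(r := b r)))"
    unfolding P_eq
    by (auto intro!: continuous_intros)
  then have "open {a :: nat \<Rightarrow> real. P (a(r := b r)) \<noteq> 0}"
    by (intro open_Collect_neq) auto
  moreover have "b'(r := b r) = b"
    using b(1) by (auto simp: b'_def fun_eq_iff PiE_def extensional_def)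
  ultimately obtain X where X: "b' \<in> (\<Pi>\<^sub>E i\<in>UNIV. X i)" "\<And>i. open (X i)"
      "(\<Pi>\<^sub>E i\<in>UNIV. X i) \<subseteq> {a. P (a(r := b r)) \<noteq> 0}"
    using product_topology_open_contains_basis[of "\<lambda>_. euclidean" UNIV
        "{a. P (a(r := b r)) \<noteq> 0}" b'] b(2)
    by (auto simp: open_fun_def)
  define U where "U = (\<Pi>\<^sub>E i\<in>{..<r}. X i \<inter> {0<..})"
  have U_sets: "U \<in> sets (\<Pi>\<^sub>M i\<in>{..<r}. lborel)"
    unfolding U_def using X(2) by (intro sets_PiM_I_finite) auto
  have U_pos: "a i > 0" if "a \<in> U" "i < r" for a i
    using that by (auto simp: U_def PiE_iff)
  have q_nz: "q a \<noteq> 0" if "a \<in> U" for a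
  proof -
    \<comment> \<open>Points of \<open>U\<close> have coordinates only below \<open>r\<close>; the box \<open>X\<close> constrains all of them.\<close>
    let ?a = "\<lambda>i. if i < r then a i else b' i"
    have "?a \<in> (\<Pi>\<^sub>E i\<in>UNIV. X i)"
      using X(1) that by (auto simp: U_def PiE_iff)
    then have "P (?a(r := b r)) \<noteq> 0"
      using X(3) by blast
    moreover have "q ?a = q a"
      by (simp add: q_def)
    ultimately show ?thesis
      by (auto simp: slice)
  qed
  have inner: "(\<integral>\<^sup>+ t. F (a(r := t)) \<partial>lborel) = \<infinity>" if "a \<in> U" for a
  proof -
    have "(\<integral>\<^sup>+ t. F (a(r := t)) \<partial>lborel) = (\<integral>\<^sup>+ t\<in>{0<..}.
        ennreal ((\<Prod>i<r. a i) * t * (cmod (poly (q a) (complex_of_real t)))\<^sup>2) \<partial>lborel)"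
    proof (rule nn_integral_cong)
      fix t :: real
      have "a(r := t) \<in> ({..<Suc r} \<rightarrow>\<^sub>E {0<..}) \<longleftrightarrow> t > 0"
        using that U_pos[OF that] by (auto simp: U_def PiE_iff extensional_def less_Suc_eq)
      then show "F (a(r := t)) = ennreal ((\<Prod>i<r. a i) * t *
          (cmod (poly (q a) (complex_of_real t)))\<^sup>2) * indicator {0<..} t"
        by (simp add: F_def slice indicator_def)
    qed
    also have "\<dots> = \<infinity>"
      using q_nz[OF that] U_pos[OF that] by (intro nn_integral_poly_half_line prod_pos) auto
    finally show ?thesis .
  qed
  have "emeasure (\<Pi>\<^sub>M i\<in>{..<r}. lborel) U = (\<Prod>i<r. emeasure lborel (X i \<inter> {0<..}))"
    unfolding U_def using X(2) by (intro emeasure_PiM) auto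
  moreover have "emeasure lborel (X i \<inter> {0<..}) \<noteq> 0" if "i < r" for i
  proof -
    have "b i \<in> X i \<inter> {0<..}"
      using X(1) b(1) that by (auto simp: b'_def PiE_iff split: if_splits dest!: spec[of _ i])
    moreover have "open (X i \<inter> {0<..})"
      using X(2) by auto
    ultimately have "\<not> negligible (X i \<inter> {0<..})"
      using open_not_negligible by blast
    then show ?thesis
      using X(2) by (simp add: negligible_iff_emeasure0)
  qed
  ultimately have U_nz: "emeasure (\<Pi>\<^sub>M i\<in>{..<r}. lborel) U \<noteq> 0"
    by (simp add: prod_zero_iff)
  have "\<infinity> = \<infinity> * emeasure (\<Pi>\<^sub>M i\<in>{..<r}. lborel) U"
    using U_nz by (simp add: ennreal_top_mult)
  also have "\<dots> = (\<integral>\<^sup>+ a. \<infinity> * indicator U a \<partial>(\<Pi>\<^sub>M i\<in>{..<r}. lborel))"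
    using U_sets by (simp add: nn_integral_cmult_indicator)
  also have "\<dots> \<le> (\<integral>\<^sup>+ a. (\<integral>\<^sup>+ t. F (a(r := t)) \<partial>lborel) \<partial>(\<Pi>\<^sub>M i\<in>{..<r}. lborel))"
    by (intro nn_integral_mono) (auto simp: indicator_def inner)
  also have "\<dots> = integral\<^sup>N (\<Pi>\<^sub>M i\<in>insert r {..<r}. lborel) F"
    using F_meas by (intro product_nn_integral_insert[symmetric]) auto
  finally have "integral\<^sup>N (\<Pi>\<^sub>M i\<in>{..<Suc r}. lborel) F = \<infinity>"
    unfolding lessThan_Suc by (simp add: top_unique)
  then show ?thesis
    unfolding F_def .
qed

text \<open>The coordinates fill the whole open orthant, so that \<open>f\<close> is determined there by the function
  it induces on the Toda space; the trace \<open>c\<close> is placed in the first diagonal entry.\<close>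

lemma a_coords_surj:
  assumes a: "a \<in> {..<n - 1} \<rightarrow>\<^sub>E {0<..}" and n: "n > 0"
  obtains T where "T \<in> toda_space n c" "a_coords n T = a"
proof
  define T where "T = mat n n (\<lambda>(i, j). if j = Suc i then a i else if i = 0 \<and> j = 0 then c else 0)"
  have "(\<Sum>i<n. T $$ (i, i)) = (\<Sum>i<n. if i = 0 then c else 0)"
    by (intro sum.cong) (auto simp: T_def)
  also have "\<dots> = c"
    using n by simp
  finally show "T \<in> toda_space n c"
    using a by (auto simp: toda_space_def T_def PiE_iff)
  show "a_coords n T = a"
    using a by (auto simp: a_coords_def T_def PiE_iff extensional_def fun_eq_iff)
qed

lemma a_coords_pos: "T \<in> toda_space n c \<Longrightarrow> a_coords n T \<in> {..<n - 1} \<rightarrow>\<^sub>E {0<..}"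
  by (auto simp: a_coords_def toda_space_def)

lemma L2_sq_V_space:
  assumes n: "n \<ge> 2" and V: "as_toda_fun n c f \<in> V_space n c m" and nz: "as_toda_fun n c f \<noteq> 0"
  shows "L2_sq (n - 1) f = \<infinity>"
proof -
  obtain r where r: "n - 1 = Suc r"
    using n by (cases "n - 1") auto
  obtain P where P: "P \<in> poly_funs (Suc r) m"
    and eq: "as_toda_fun n c f = as_toda_fun n c (\<lambda>a. complex_of_real (\<Prod>i<Suc r. a i) * P a)"
    using V unfolding V_space_def r by blast
  have f: "f a = complex_of_real (\<Prod>i<Suc r. a i) * P a" if a: "a \<in> {..<Suc r} \<rightarrow>\<^sub>E {0<..}" for a
  proof -
    obtain T where "T \<in> toda_space n c" "a_coords n T = a"
      using a_coords_surj[of a n c, unfolded r] a n by auto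
    then show ?thesis
      using fun_cong[OF eq, of T] by (simp add: as_toda_fun_def)
  qed
  obtain T where T: "T \<in> toda_space n c" "f (a_coords n T) \<noteq> 0"
    using nz by (auto simp: as_toda_fun_def fun_eq_iff split: if_splits)
  let ?b = "a_coords n T"
  have b: "?b \<in> {..<Suc r} \<rightarrow>\<^sub>E {0<..}"
    using a_coords_pos[OF T(1), unfolded r] .
  have "P ?b \<noteq> 0"
    using f[OF b] T(2) by auto
  have "L2_sq (n - 1) f = (\<integral>\<^sup>+ a\<in>({..<Suc r} \<rightarrow>\<^sub>E {0<..}).
      ennreal ((\<Prod>i<Suc r. a i) * (cmod (P a))\<^sup>2) \<partial>(\<Pi>\<^sub>M i\<in>{..<Suc r}. lborel))"
    unfolding L2_sq_def r
  proof (rule nn_integral_cong)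
    fix a :: "nat \<Rightarrow> real"
    have "(cmod (f a))\<^sup>2 / (\<Prod>i<Suc r. a i) = (\<Prod>i<Suc r. a i) * (cmod (P a))\<^sup>2"
      if a: "a \<in> {..<Suc r} \<rightarrow>\<^sub>E {0<..}"
    proof -
      have "(\<Prod>i<Suc r. a i) > 0"
        using a by (intro prod_pos) (auto simp: PiE_iff)
      then show ?thesis
        unfolding f[OF a] norm_mult norm_of_real by (simp add: power2_eq_square del: prod.lessThan_Suc)
    qed
    then show "ennreal ((cmod (f a))\<^sup>2 / (\<Prod>i<Suc r. a i)) * indicator ({..<Suc r} \<rightarrow>\<^sub>E {0<..}) a =
        ennreal ((\<Prod>i<Suc r. a i) * (cmod (P a))\<^sup>2) * indicator ({..<Suc r} \<rightarrow>\<^sub>E {0<..}) a"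
      by (auto simp: indicator_def simp del: prod.lessThan_Suc)
  qed
  also have "\<dots> = \<infinity>"
    by (rule nn_integral_poly_fun_orthant[OF P b \<open>P ?b \<noteq> 0\<close>])
  finally show ?thesis .
qed

theorem mainTheorem4:
  fixes n m :: nat and c :: real
  assumes "n \<ge> 2"
  shows "(\<forall>g \<in> carrier (G1 n). \<forall>s \<in> V_space n c m. fun_act n c g s \<in> V_space n c m) \<and>
    finite_dim_rep (G1 n) (V_space n c m) (fun_act n c) \<and>
    (\<forall>f :: (nat \<Rightarrow> real) \<Rightarrow> complex.
       as_toda_fun n c f \<in> V_space n c m \<and> as_toda_fun n c f \<noteq> 0 \<longrightarrow> L2_sq (n - 1) f = \<infinity>)"
proof (intro conjI ballI allI impI)
  show "fun_act n c g s \<in> V_space n c m" if "g \<in> carrier (G1 n)" "s \<in> V_space n c m" for g s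
    using that by (rule fun_act_V_space)
  show "finite_dim_rep (G1 n) (V_space n c m) (fun_act n c)"
    by (rule finite_dim_rep_V_space)
  show "L2_sq (n - 1) f = \<infinity>"
    if "as_toda_fun n c f \<in> V_space n c m \<and> as_toda_fun n c f \<noteq> 0" for f
    by (rule L2_sq_V_space[OF assms conjunct1[OF that] conjunct2[OF that]])
qed

end
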